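(* Let $\theta>0$. The sequences of random variables $(n\mathcal D_n)_{n\ge1}$, $(n\widetilde{\mathcal D}_n)_{n\ge1}$, $\left(\frac1{n\mathcal D_n}\right)_{n\ge1}$ and $\left(\frac1{n\widetilde{\mathcal D}_n}\right)_{n\ge1}$ are tight.
   Context: For each $n\ge1$, $\sigma_n$ is a random permutation in the symmetric group $\mathfrak S_n$ following the Ewens measure of parameter $\theta>0$: $\mathbb P(\sigma_n=\sigma)=\dfrac{\theta^{K(\sigma)}}{\theta(\theta+1)\cdots(\theta+n-1)}$, where $K(\sigma)$ is the total number of cycles of $\sigma$ (fixed points included). $(z_j)_{j\ge1}$ is a sequence of i.i.d. random variables uniformly distributed on the unit circle, independent of $(\sigma_n)_{n\ge1}$. The $n\times n$ random matrices $M_n$ and $\widetilde M_n$ have entries $(M_n)_{i,j}=\mathds{1}_{i=\sigma_n(j)}$ and $(\widetilde M_n)_{i,j}=z_i\mathds{1}_{i=\sigma_n(j)}$. Their eigenvalues lie on the unit circle. $\mathcal D_n$ (resp. $\widetilde{\mathcal D}_n$) is the largest spacing between two consecutive distinct eigenangles of $M_n$ (resp. $\widetilde M_n$): the distinct eigenvalues cut the unit circle into arcs, and the spacings are the lengths of these arcs (the total being $2\pi$); if there is only one distinct eigenvalue the spacing is $2\pi$. A sequence $(Y_n)$ of real random variables is tight if for every $\varepsilon>0$ there is $\eta>0$ such that $\mathbb P(|Y_n|\le\eta)\ge1-\varepsilon$ for all $n$. *)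

theory Defs
  imports
    "HOL-Probability.Probability"
    "HOL-Combinatorics.Permutations"
    "HOL-Combinatorics.Orbits"
    "Jordan_Normal_Form.Char_Poly"
begin

definition num_cycles :: "nat \<Rightarrow> (nat \<Rightarrow> nat) \<Rightarrow> nat" where
  "num_cycles n p = card (Orbits.orbit p ` {1..n})"

definition ewens :: "real \<Rightarrow> nat \<Rightarrow> (nat \<Rightarrow> nat) \<Rightarrow> real" where
  "ewens \<theta> n p = \<theta> ^ num_cycles n p / pochhammer \<theta> n"

definition circle_uniform :: "complex measure" where
  "circle_uniform = distr (uniform_measure lborel {0..<2 * pi}) borel cis"

(* Independence of two random variables with values in different types; the predicate indep_var
   of the library, of which this copies the characterization indep_var_eq, requires equal types. *)

definition indep_rv ::
  "'a measure \<Rightarrow> 'b measure \<Rightarrow> ('a \<Rightarrow> 'b) \<Rightarrow> 'c measure \<Rightarrow> ('a \<Rightarrow> 'c) \<Rightarrow> bool" where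
  "indep_rv M S X T Y \<longleftrightarrow> X \<in> measurable M S \<and> Y \<in> measurable M T \<and>
     prob_space.indep_set M
       (sigma_sets (space M) {X -` A \<inter> space M | A. A \<in> sets S})
       (sigma_sets (space M) {Y -` A \<inter> space M | A. A \<in> sets T})"

lemma (in prob_space) indep_rv_iff_indep_var: "indep_rv M S X T Y \<longleftrightarrow> indep_var S X T Y"
  unfolding indep_rv_def indep_var_eq by blast

(* Permutations and the sequence z are indexed from 1, as usual for the symmetric group on
   {1..n}; the entries of a matrix of type mat are indexed from 0, hence the shifts by Suc. *)

definition perm_mat :: "nat \<Rightarrow> (nat \<Rightarrow> nat) \<Rightarrow> complex mat" where
  "perm_mat n p = mat n n (\<lambda>(i, j). if Suc i = p (Suc j) then 1 else 0)"

definition weighted_perm_mat :: "nat \<Rightarrow> (nat \<Rightarrow> complex) \<Rightarrow> (nat \<Rightarrow> nat) \<Rightarrow> complex mat" where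
  "weighted_perm_mat n w p = mat n n (\<lambda>(i, j). if Suc i = p (Suc j) then w (Suc i) else 0)"

(* All real determinations of the eigenangles are kept: this is a 2*pi-periodic subset of the
   line, so that two consecutive elements are the endpoints of an arc of the circle cut by the
   eigenvalues, the arc through the angle 0 needs no special treatment, and a single eigenvalue
   gives the spacing 2*pi. *)

definition eigenangles :: "complex mat \<Rightarrow> real set" where
  "eigenangles A = {t. eigenvalue A (cis t)}"

definition spacings :: "complex mat \<Rightarrow> real set" where
  "spacings A = {b - a | a b. a \<in> eigenangles A \<and> b \<in> eigenangles A \<and> a < b \<and>
     {a<..<b} \<inter> eigenangles A = {}}"

(* For matrices with finitely many eigenvalues, at least one of them of modulus 1, the set of
   spacings is finite and nonempty. Otherwise Max may be an unspecified value; for the random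
   matrices considered here this can only happen on a null set, where some weight is off the
   unit circle. *)

definition max_spacing :: "complex mat \<Rightarrow> real" where
  "max_spacing A = Max (spacings A)"

(* Tightness of (Y n) for n \<ge> 1 is tightness of the laws. The predicate tight of the library is
   about sequences indexed from 0. *)

definition tight_seq :: "'a measure \<Rightarrow> (nat \<Rightarrow> 'a \<Rightarrow> real) \<Rightarrow> bool" where
  "tight_seq M Y \<longleftrightarrow> tight (\<lambda>n. distr M borel (Y (Suc n)))"

lemma measurable_if_prob_space_distr:
  fixes Y :: "'a \<Rightarrow> real"
  assumes "prob_space (distr M borel Y)" "prob_space M"
  shows "Y \<in> borel_measurable M"
proof (rule measurableI)
  fix A :: "real set" assume A: "A \<in> sets borel"
  interpret D: prob_space "distr M borel Y" by fact
  interpret prob_space M by fact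
  let ?N = "distr M borel Y"
  show "Y -` A \<inter> space M \<in> sets M"
  proof (rule ccontr)
    assume nA: "Y -` A \<inter> space M \<notin> sets M"
    have nB: "Y -` (- A) \<inter> space M \<notin> sets M"
    proof
      assume "Y -` (- A) \<inter> space M \<in> sets M"
      then have "space M - (Y -` (- A) \<inter> space M) \<in> sets M" by blast
      moreover have "space M - (Y -` (- A) \<inter> space M) = Y -` A \<inter> space M" by auto
      ultimately show False using nA by simp
    qed
    have *: "emeasure ?N B = 0" if "B \<in> sets borel" "Y -` B \<inter> space M \<notin> sets M" for B
    proof -
      have "emeasure ?N B = (if measure_space (space borel) (sets borel) (\<lambda>A. emeasure M (Y -` A \<inter> space M))
          then emeasure M (Y -` B \<inter> space M) else 0)"
        using that(1) unfolding distr_def emeasure_measure_of_conv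
        by (simp add: sets.sigma_sets_eq[of borel, simplified])
      then show ?thesis using that(2) by (simp add: emeasure_notin_sets)
    qed
    have "emeasure ?N (space ?N) = emeasure ?N A + emeasure ?N (- A)"
      using A by (subst plus_emeasure) (auto simp: Compl_partition)
    also have "\<dots> = 0" using *[OF A nA] *[OF borel_comp[OF A] nB] by simp
    finally show False using D.emeasure_space_1 by simp
  qed
qed simp

lemma tight_seq_iff:
  assumes "prob_space M"
  shows "tight_seq M Y \<longleftrightarrow>
    (\<forall>n\<ge>1. Y n \<in> borel_measurable M) \<and>
    (\<forall>\<epsilon>>0. \<exists>\<eta>>0. \<forall>n\<ge>1. measure M {\<omega> \<in> space M. \<bar>Y n \<omega>\<bar> \<le> \<eta>} \<ge> 1 - \<epsilon>)"
    (is "?L \<longleftrightarrow> ?M \<and> ?R")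
proof -
  interpret prob_space M by fact
  have all1: "(\<forall>n\<ge>1. P n) \<longleftrightarrow> (\<forall>n. P (Suc n))" for P
    by (metis One_nat_def Suc_le_mono le0 not0_implies_Suc not_one_le_zero)
  have meas: "?M \<longleftrightarrow> (\<forall>n. Y (Suc n) \<in> borel_measurable M)"
    unfolding all1 ..
  have R: "?R \<longleftrightarrow> (\<forall>\<epsilon>>0. \<exists>\<eta>>0. \<forall>n. measure M {\<omega> \<in> space M. \<bar>Y (Suc n) \<omega>\<bar> \<le> \<eta>} \<ge> 1 - \<epsilon>)"
    unfolding all1 ..
  have D: "(\<forall>n. real_distribution (distr M borel (Y (Suc n)))) \<longleftrightarrow> ?M"
    unfolding meas using measurable_if_prob_space_distr[OF _ assms] real_distribution_distr
    by (blast dest: real_distribution.axioms(1))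
  have "(\<forall>\<epsilon>>0. \<exists>a b::real. a < b \<and> (\<forall>n. measure (distr M borel (Y (Suc n))) {a<..b} > 1 - \<epsilon>)) \<longleftrightarrow> ?R"
    (is "?T \<longleftrightarrow> _") if m: ?M
  proof
    have m': "Y (Suc n) \<in> borel_measurable M" for n using m meas by blast
    show ?R if ?T
      unfolding R
    proof (intro allI impI)
      fix \<epsilon> :: real assume "\<epsilon> > 0"
      then obtain a b where ab: "a < b" "\<And>n. measure (distr M borel (Y (Suc n))) {a<..b} > 1 - \<epsilon>"
        using \<open>?T\<close> by meson
      have "measure M {\<omega> \<in> space M. \<bar>Y (Suc n) \<omega>\<bar> \<le> \<bar>a\<bar> + \<bar>b\<bar> + 1} \<ge> 1 - \<epsilon>" for n
      proof -
        have "1 - \<epsilon> < measure M (Y (Suc n) -` {a<..b} \<inter> space M)"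
          using ab(2)[of n] m' by (simp add: measure_distr)
        also have "\<dots> \<le> measure M {\<omega> \<in> space M. \<bar>Y (Suc n) \<omega>\<bar> \<le> \<bar>a\<bar> + \<bar>b\<bar> + 1}"
          using m'[of n] by (intro finite_measure_mono) auto
        finally show ?thesis by simp
      qed
      then show "\<exists>\<eta>>0. \<forall>n. measure M {\<omega> \<in> space M. \<bar>Y (Suc n) \<omega>\<bar> \<le> \<eta>} \<ge> 1 - \<epsilon>"
        by (intro exI[of _ "\<bar>a\<bar> + \<bar>b\<bar> + 1"]) auto
    qed
    show ?T if ?R
    proof (intro allI impI)
      fix \<epsilon> :: real assume "\<epsilon> > 0"
      then have "\<epsilon> / 2 > 0" by simp
      then obtain \<eta> where \<eta>: "\<eta> > 0"
        "\<And>n. measure M {\<omega> \<in> space M. \<bar>Y (Suc n) \<omega>\<bar> \<le> \<eta>} \<ge> 1 - \<epsilon> / 2"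
        using \<open>?R\<close>[unfolded R] by meson
      have "measure (distr M borel (Y (Suc n))) {- \<eta> - 1<..\<eta>} > 1 - \<epsilon>" for n
      proof -
        have "1 - \<epsilon> < measure M {\<omega> \<in> space M. \<bar>Y (Suc n) \<omega>\<bar> \<le> \<eta>}"
          using \<eta>(2)[of n] \<open>\<epsilon> > 0\<close> by simp
        also have "\<dots> \<le> measure M (Y (Suc n) -` {- \<eta> - 1<..\<eta>} \<inter> space M)"
          using m'[of n] by (intro finite_measure_mono) (auto intro: measurable_sets)
        finally show ?thesis using m' by (simp add: measure_distr)
      qed
      then show "\<exists>a b. a < b \<and> (\<forall>n. measure (distr M borel (Y (Suc n))) {a<..b} > 1 - \<epsilon>)"
        using \<open>\<eta> > 0\<close> by (intro exI[of _ "- \<eta> - 1"] exI[of _ \<eta>]) auto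
    qed
  qed
  with D show ?thesis unfolding tight_seq_def tight_def by blast
qed

end

theory Submission
  imports Defs "Jordan_Normal_Form.Spectral_Radius"
begin

text \<open>There are at most \<open>n\<close> distinct eigenvalues, so \<open>n D\<close> is at least \<open>2 pi\<close>, which settles
  \<open>1 / (n D)\<close>. Conversely the cycle of 1, of length \<open>l\<close>, contributes all the \<open>l\<close>-th roots of one
  number of modulus 1, so \<open>D \<le> 2 pi / l\<close> and it remains to see that \<open>n / l\<close> is tight. This follows
  from Markov's inequality for a decreasing function of \<open>l\<close> of order \<open>l powr (-1/2)\<close>, whose Ewens
  expectation is computed by inserting the points one by one. The unweighted matrices are the
  case of weights 1.\<close>

subsection \<open>The cycle of 1 under the Ewens measure\<close>

text \<open>The exponent -1/2 is a compromise: for \<open>\<theta> = 1\<close> the length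
  \<open>l\<close> is uniform on \<open>{1..n}\<close>, so the expectation of \<open>n / l\<close>
  is a harmonic number and grows with \<open>n\<close>, whereas that of \<open>sqrt (n / l)\<close>
  stays bounded. Following one prescribed point instead of the longest cycle keeps the recursion
  simple: inserting a point changes \<open>l\<close> by at most one, with odds that depend only on
  \<open>l\<close>, \<open>n\<close> and \<open>\<theta>\<close>. The two bounds on \<open>D\<close>
  hold for every permutation and all weights of modulus 1. Random weights have modulus 1 only almost
  surely, so these bounds are used almost everywhere; but measurability of \<open>D\<close> is part
  of tightness and has to be shown on the whole space, including points where there is no eigenangle
  at all.\<close>

lemma transpose_comp_permutes_insert:
  assumes "q permutes S" "b \<in> S"
  shows "(Transposition.transpose a b \<circ> q) permutes insert a S"
  using assms by (intro permutes_compose[OF permutes_subset[OF assms(1)]] permutes_swap_id) auto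

text \<open>Since \<open>q\<close> fixes \<open>a\<close>, the composition sends the
  \<open>q\<close>-preimage of \<open>b\<close> to \<open>a\<close>, sends \<open>a\<close> to
  \<open>b\<close> and changes nothing else: \<open>a\<close> is spliced into the cycle of
  \<open>b\<close>, just before \<open>b\<close>.\<close>

lemma orbit_transpose_comp:
  assumes q: "q permutes S" and "a \<notin> S" "b \<in> S" "x \<in> S"
  shows "orbit (Transposition.transpose a b \<circ> q) x = (if b \<in> orbit q x then insert a (orbit q x) else orbit q x)"
proof -
  define p where "p = Transposition.transpose a b \<circ> q"
  have pa: "p a = b" unfolding p_def using q \<open>a \<notin> S\<close> by (simp add: permutes_not_in)
  have sub: "orbit q x \<subseteq> S" using permutes_orbit_subset[OF q \<open>x \<in> S\<close>] .
  have qS: "q y \<in> S" if "y \<in> S" for y using permutes_in_image[OF q] that by blast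
  have py: "p y = (if q y = b then a else q y)" if "y \<in> S" for y
    using qS[OF that] \<open>a \<notin> S\<close> unfolding p_def by (auto simp: Transposition.transpose_def)
  have ge: "orbit q x \<subseteq> orbit p x"
  proof
    fix y assume "y \<in> orbit q x"
    then show "y \<in> orbit p x"
    proof induction
      case base
      then show ?case using py[OF \<open>x \<in> S\<close>] pa by (metis orbit.base orbit.step)
    next
      case (step y)
      then show ?case using py[of y] sub pa by (metis orbit.step subsetD)
    qed
  qed
  have a: "a \<in> orbit p x" if "b \<in> orbit q x"
    using that
  proof cases
    case base
    then show ?thesis using py[OF \<open>x \<in> S\<close>] by (metis orbit.base)
  next
    case (step y)
    then show ?thesis using py[of y] sub ge by (metis orbit.step subsetD)
  qed
  have le: "orbit p x \<subseteq> (if b \<in> orbit q x then insert a (orbit q x) else orbit q x)"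
  proof
    fix y assume "y \<in> orbit p x"
    then show "y \<in> (if b \<in> orbit q x then insert a (orbit q x) else orbit q x)"
    proof induction
      case base
      then show ?case using py[OF \<open>x \<in> S\<close>] orbit.base[of q x] by (auto split: if_splits)
    next
      case (step y)
      then have "y \<in> orbit q x \<or> y = a \<and> b \<in> orbit q x" by (auto split: if_splits)
      then show ?case
      proof
        assume y: "y \<in> orbit q x"
        then show ?thesis using py[of y] sub orbit.step[OF y] by (auto split: if_splits)
      qed (auto simp: pa)
    qed
  qed
  show ?thesis using ge a le unfolding p_def[symmetric] by (auto split: if_splits)
qed

text \<open>This is the insertion with \<open>b = a\<close>, where the transposition is the
  identity: the new point forms its own cycle. It is the only insertion that brings a factor
  \<open>\<theta>\<close>.\<close>

lemma card_orbits_insert_fixpoint: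
  assumes "q permutes S" "finite S" "a \<notin> S"
  shows "card (orbit q ` insert a S) = Suc (card (orbit q ` S))"
proof -
  have "orbit q a = {a}" using assms by (simp add: orbit_eq_singleton_iff permutes_not_in)
  moreover have "{a} \<notin> orbit q ` S" using permutes_orbit_subset[OF assms(1)] \<open>a \<notin> S\<close> by fastforce
  ultimately show ?thesis using \<open>finite S\<close> by simp
qed

text \<open>The point \<open>a\<close> lies on the orbit of \<open>b\<close>, so no orbit is lost by
  leaving \<open>a\<close> out of the index set. Adding \<open>a\<close> to the orbit through
  \<open>b\<close> is injective on the old orbits because none of them contains
  \<open>a\<close>.\<close>

lemma card_orbits_transpose_comp:
  assumes q: "q permutes S" and "finite S" "a \<notin> S" "b \<in> S"
  shows "card (orbit (Transposition.transpose a b \<circ> q) ` insert a S) = card (orbit q ` S)"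
proof -
  let ?p = "Transposition.transpose a b \<circ> q"
  have perm: "permutation ?p"
    using transpose_comp_permutes_insert[OF q \<open>b \<in> S\<close>, of a] \<open>finite S\<close>
    by (metis finite_insert permutation_permutes)
  have "?p a = b" using q \<open>a \<notin> S\<close> by (simp add: permutes_not_in)
  then have "orbit ?p a = orbit ?p b" using permutation_orbit_step[OF perm, of a] by simp
  then have "orbit ?p ` insert a S = orbit ?p ` S" using \<open>b \<in> S\<close> by auto
  also have "\<dots> = (\<lambda>A. if b \<in> A then insert a A else A) ` orbit q ` S"
    unfolding image_image using orbit_transpose_comp[OF q assms(3,4)] by (intro image_cong) auto
  also have "card \<dots> = card (orbit q ` S)"
  proof (rule card_image, rule inj_onI)
    fix A B assume "A \<in> orbit q ` S" "B \<in> orbit q ` S"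
      and eq: "(if b \<in> A then insert a A else A) = (if b \<in> B then insert a B else B)"
    then have "a \<notin> A" "a \<notin> B" using permutes_orbit_subset[OF q] \<open>a \<notin> S\<close> by blast+
    then show "A = B" using eq by (auto split: if_splits)
  qed
  finally show ?thesis .
qed

text \<open>One step of the Chinese restaurant process, without normalization. Every permutation of
  \<open>{1..Suc n}\<close> comes from exactly one pair of \<open>q\<close> and \<open>b\<close>.
  Among the choices \<open>b \<le> n\<close>, those on the cycle of 1 lengthen it and the others
  leave it alone; \<open>b = Suc n\<close> leaves it alone with weight
  \<open>\<theta>\<close>.\<close>

lemma sum_permutations_Suc:
  fixes f :: "nat \<Rightarrow> real"
  assumes "n \<ge> 1"
  shows "(\<Sum>p | p permutes {1..Suc n}. \<theta> ^ num_cycles (Suc n) p * f (card (orbit p 1))) =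
    (\<Sum>q | q permutes {1..n}. \<theta> ^ num_cycles n q *
      ((\<theta> + real n - real (card (orbit q 1))) * f (card (orbit q 1)) +
       real (card (orbit q 1)) * f (Suc (card (orbit q 1)))))"
proof -
  define w where "w p = \<theta> ^ num_cycles (Suc n) p * f (card (orbit p 1))" for p
  have ins: "{1..Suc n} = insert (Suc n) {1..n}" by auto
  have 1: "(1::nat) \<in> {1..n}" using assms by auto
  have "(\<Sum>p | p permutes {1..Suc n}. w p) =
      (\<Sum>b\<in>insert (Suc n) {1..n}. \<Sum>q | q permutes {1..n}. w (Transposition.transpose (Suc n) b \<circ> q))"
    unfolding ins by (rule sum_over_permutations_insert) auto
  also have "\<dots> = (\<Sum>q | q permutes {1..n}. \<Sum>b\<in>insert (Suc n) {1..n}. w (Transposition.transpose (Suc n) b \<circ> q))"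
    by (rule sum.swap)
  also have "\<dots> = (\<Sum>q | q permutes {1..n}. \<theta> ^ num_cycles n q *
      ((\<theta> + real n - real (card (orbit q 1))) * f (card (orbit q 1)) +
       real (card (orbit q 1)) * f (Suc (card (orbit q 1)))))"
  proof (rule sum.cong[OF refl])
    fix q assume "q \<in> {q. q permutes {1..n}}"
    then have q: "q permutes {1..n}" by simp
    let ?l = "card (orbit q 1)"
    have sub: "orbit q 1 \<subseteq> {1..n}" using permutes_orbit_subset[OF q 1] .
    then have fin: "finite (orbit q 1)" by (rule finite_subset) simp
    have "w (Transposition.transpose (Suc n) b \<circ> q) = \<theta> ^ num_cycles n q * (if b \<in> orbit q 1 then f (Suc ?l) else f ?l)"
      if b: "b \<in> {1..n}" for b
    proof -
      have "Suc n \<notin> orbit q 1" using sub by auto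
      then show ?thesis
        using card_orbits_transpose_comp[OF q _ _ b, of "Suc n"]
          orbit_transpose_comp[OF q _ b 1, of "Suc n"] fin
        unfolding w_def num_cycles_def ins by simp
    qed
    then have "(\<Sum>b\<in>{1..n}. w (Transposition.transpose (Suc n) b \<circ> q)) =
        \<theta> ^ num_cycles n q * (\<Sum>b\<in>{1..n}. if b \<in> orbit q 1 then f (Suc ?l) else f ?l)"
      unfolding sum_distrib_left by (rule sum.cong[OF refl])
    also have "(\<Sum>b\<in>{1..n}. if b \<in> orbit q 1 then f (Suc ?l) else f ?l) =
        real ?l * f (Suc ?l) + (real n - real ?l) * f ?l"
    proof -
      have "{1..n} \<inter> orbit q 1 = orbit q 1" using sub by blast
      moreover have "card ({1..n} \<inter> - orbit q 1) = n - ?l"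
        using card_Diff_subset[OF fin sub] by (simp add: Diff_eq)
      moreover have "?l \<le> n" using card_mono[OF _ sub] by simp
      ultimately show ?thesis by (simp add: sum.If_cases of_nat_diff)
    qed
    finally have S: "(\<Sum>b\<in>{1..n}. w (Transposition.transpose (Suc n) b \<circ> q)) =
      \<theta> ^ num_cycles n q * (real ?l * f (Suc ?l) + (real n - real ?l) * f ?l)" .
    have "w (Transposition.transpose (Suc n) (Suc n) \<circ> q) = \<theta> ^ num_cycles n q * (\<theta> * f ?l)"
      using card_orbits_insert_fixpoint[OF q, of "Suc n"] unfolding w_def num_cycles_def ins by simp
    with S show "(\<Sum>b\<in>insert (Suc n) {1..n}. w (Transposition.transpose (Suc n) b \<circ> q)) =
      \<theta> ^ num_cycles n q * ((\<theta> + real n - real ?l) * f ?l + real ?l * f (Suc ?l))"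
      by (simp add: algebra_simps)
  qed
  finally show ?thesis unfolding w_def .
qed

lemma card_orbit_permutes:
  assumes "p permutes {1..n}" "j \<in> {1..n}"
  shows "1 \<le> card (orbit p j)" "card (orbit p j) \<le> n"
proof -
  have "orbit p j \<subseteq> {1..n}" using permutes_orbit_subset[OF assms] .
  then have "finite (orbit p j)" "card (orbit p j) \<le> card {1..n}"
    by (auto intro: finite_subset dest: card_mono[rotated])
  then show "1 \<le> card (orbit p j)" "card (orbit p j) \<le> n"
    using orbit_nonempty[of p j] by (auto simp: Suc_le_eq card_gt_0_iff)
qed

text \<open>The weight \<open>f(k) = (2(k-1) choose (k-1)) / 4 ^ (k-1)\<close>, of order \<open>k powr (-1/2)\<close>, is chosen so that
  \<open>k f(k+1) = (k - 1/2) f(k)\<close>. Inserting a new point lengthens the cycle of 1, of length \<open>k\<close>, with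
  weight \<open>k\<close>, so the weighted sums of \<open>f\<close> over permutations satisfy a closed recursion.\<close>

definition cycle_moment :: "nat \<Rightarrow> real" where
  "cycle_moment k = pochhammer (1/2) (k - 1) / fact (k - 1)"

lemma cycle_moment_Suc:
  assumes "k \<ge> 1" shows "real k * cycle_moment (Suc k) = (real k - 1/2) * cycle_moment k"
proof -
  obtain m where "k = Suc m" using assms by (cases k) auto
  then show ?thesis unfolding cycle_moment_def by (simp add: pochhammer_Suc divide_simps)
qed

lemma cycle_moment_pos: "cycle_moment k > 0"
  unfolding cycle_moment_def by (simp add: pochhammer_pos)

text \<open>Squares keep the induction polynomial. With \<open>x = k\<close>, the step reduces to
  x^2 (4x - 3) \<le> (x - 1/2)^2 (4x + 1), whose sides differ by exactly 1/4; at
  \<open>k = 1\<close> the bound is an equality.\<close>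

lemma cycle_moment_lower:
  assumes "k \<ge> 1" shows "(cycle_moment k)\<^sup>2 * (4 * real k - 3) \<ge> 1"
  using assms
proof (induction k rule: dec_induct)
  case base
  then show ?case by (simp add: cycle_moment_def)
next
  case (step k)
  define x where "x = real k"
  have x: "x \<ge> 1" using step by (simp add: x_def)
  have "x\<^sup>2 * ((cycle_moment k)\<^sup>2 * (4 * x - 3)) \<le> (x * cycle_moment (Suc k))\<^sup>2 * (4 * x + 1)"
  proof -
    have "x\<^sup>2 * (4 * x - 3) \<le> (x - 1/2)\<^sup>2 * (4 * x + 1)"
      by (simp add: power2_eq_square algebra_simps)
    then have "(cycle_moment k)\<^sup>2 * (x\<^sup>2 * (4 * x - 3)) \<le> (cycle_moment k)\<^sup>2 * ((x - 1/2)\<^sup>2 * (4 * x + 1))"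
      by (intro mult_left_mono) auto
    moreover have "x * cycle_moment (Suc k) = (x - 1/2) * cycle_moment k"
      using cycle_moment_Suc[of k] step by (simp add: x_def)
    ultimately show ?thesis by (simp add: power_mult_distrib mult_ac)
  qed
  moreover have "x\<^sup>2 * 1 \<le> x\<^sup>2 * ((cycle_moment k)\<^sup>2 * (4 * x - 3))"
    using step.IH by (intro mult_left_mono) (auto simp: x_def)
  ultimately have "x\<^sup>2 * 1 \<le> x\<^sup>2 * ((cycle_moment (Suc k))\<^sup>2 * (4 * x + 1))"
    by (simp add: power_mult_distrib mult_ac)
  then have "1 \<le> (cycle_moment (Suc k))\<^sup>2 * (4 * x + 1)"
    using x by (subst (asm) mult_le_cancel_left_pos) auto
  then show ?case by (simp add: x_def algebra_simps)
qed

text \<open>The left-hand side is nonincreasing in \<open>n\<close> and equals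
  \<open>1 + \<theta>\<close> at \<open>n = 1\<close>. It amounts to a decay of the expectation of
  order \<open>n powr (-1/2)\<close>.\<close>

lemma ewens_cycle_moment:
  fixes \<theta> :: real
  assumes "\<theta> > 0" "n \<ge> 1"
  shows "(\<Sum>p | p permutes {1..n}. ewens \<theta> n p * cycle_moment (card (orbit p 1)))\<^sup>2 * (real n + \<theta>) \<le> 1 + \<theta>"
  using assms(2)
proof (induction n rule: dec_induct)
  case base
  have *: "{p. p permutes {1..1::nat}} = {id}"
    unfolding atLeastAtMost_singleton permutes_sing by simp
  have "orbit id (1::nat) = {1}" by (simp only: orbit_eq_singleton_iff id_apply)
  then have "ewens \<theta> 1 id * cycle_moment (card (orbit id (1::nat))) = 1"
    using assms by (simp add: ewens_def num_cycles_def cycle_moment_def)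
  then show ?case unfolding * by (simp add: id_def)
next
  case (step n)
  define E where "E n = (\<Sum>p | p permutes {1..n}. ewens \<theta> n p * cycle_moment (card (orbit p 1)))" for n
  define W where "W n = (\<Sum>p | p permutes {1..n}. \<theta> ^ num_cycles n p * cycle_moment (card (orbit p 1)))" for n
  define a where "a = real n + \<theta>"
  have a: "a > 1" using assms step by (simp add: a_def)
  have EW: "E n = W n / pochhammer \<theta> n" for n
    unfolding E_def W_def ewens_def sum_divide_distrib times_divide_eq_left ..
  \<comment> \<open>With \<open>k\<close> the length of the cycle of 1, the coefficients
    \<open>\<theta> + n - k\<close> and \<open>k - 1/2\<close> add up to a factor free of
    \<open>k\<close>, which can be pulled out of the sum.\<close>
  have "W (Suc n) = (\<Sum>q | q permutes {1..n}. \<theta> ^ num_cycles n q *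
      ((\<theta> + real n - 1/2) * cycle_moment (card (orbit q 1))))"
    unfolding W_def sum_permutations_Suc[OF step(1)]
  proof (rule sum.cong[OF refl])
    fix q assume "q \<in> {q. q permutes {1..n}}"
    then have "card (orbit q 1) \<ge> 1" using card_orbit_permutes(1)[of q n 1] step by simp
    have "real (card (orbit q 1)) * cycle_moment (Suc (card (orbit q 1))) =
        (real (card (orbit q 1)) - 1/2) * cycle_moment (card (orbit q 1))"
      by (rule cycle_moment_Suc) fact
    then show "\<theta> ^ num_cycles n q * ((\<theta> + real n - real (card (orbit q 1))) * cycle_moment (card (orbit q 1)) +
        real (card (orbit q 1)) * cycle_moment (Suc (card (orbit q 1)))) =
      \<theta> ^ num_cycles n q * ((\<theta> + real n - 1/2) * cycle_moment (card (orbit q 1)))"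
      by (simp only: distrib_right[symmetric]) simp
  qed
  also have "\<dots> = (a - 1/2) * W n"
    unfolding W_def sum_distrib_left by (rule sum.cong) (auto simp: a_def)
  finally have "a * E (Suc n) = (a - 1/2) * E n"
    using a pochhammer_pos[OF \<open>\<theta> > 0\<close>, of n] unfolding EW
    by (simp add: pochhammer_Suc a_def add.commute divide_simps)
  then have "a\<^sup>2 * ((E (Suc n))\<^sup>2 * (a + 1)) = (E n)\<^sup>2 * ((a - 1/2)\<^sup>2 * (a + 1))"
    by (metis (no_types, opaque_lifting) mult.assoc mult.commute power_mult_distrib)
  \<comment> \<open>The factors of \<open>(E n)\<^sup>2\<close> differ by (3a - 1)/4, which is
    positive since \<open>a > 1\<close>.\<close>
  also have "\<dots> \<le> (E n)\<^sup>2 * (a\<^sup>2 * a)"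
    using a by (intro mult_left_mono) (auto simp: power2_eq_square algebra_simps)
  also have "\<dots> \<le> a\<^sup>2 * (1 + \<theta>)"
    using mult_left_mono[OF step.IH, of "a\<^sup>2"]
    unfolding E_def[symmetric] a_def[symmetric] by (simp add: mult_ac)
  finally have "(E (Suc n))\<^sup>2 * (a + 1) \<le> 1 + \<theta>"
    using a by (subst (asm) mult_le_cancel_left_pos) auto
  then show ?case unfolding E_def[symmetric] by (simp add: a_def add_ac)
qed

text \<open>On a cycle shorter than \<open>\<delta> n\<close>, \<open>cycle_moment\<close> is at
  least 1 / (2 sqrt (\<delta> n)), while its expectation is at most sqrt ((1 + \<theta>) / n). The
  powers of \<open>n\<close> cancel in Markov's inequality, so the bound is uniform in
  \<open>n\<close>.\<close>

lemma ewens_small_cycle: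
  fixes \<theta> \<delta> :: real
  assumes "\<theta> > 0" "n \<ge> 1" "\<delta> > 0"
  shows "(\<Sum>p | p permutes {1..n} \<and> real (card (orbit p 1)) < \<delta> * real n. ewens \<theta> n p) \<le>
    2 * sqrt (\<delta> * (1 + \<theta>))"
proof -
  define E where "E = (\<Sum>p | p permutes {1..n}. ewens \<theta> n p * cycle_moment (card (orbit p 1)))"
  let ?B = "{p. p permutes {1..n} \<and> real (card (orbit p 1)) < \<delta> * real n}"
  have ew: "ewens \<theta> n p \<ge> 0" for p
    unfolding ewens_def using assms(1) pochhammer_pos[OF assms(1), of n] by simp
  have fin: "finite {p. p permutes {1..n}}" by (simp add: finite_permutations)
  have "sum (ewens \<theta> n) ?B \<le> (\<Sum>p\<in>?B. 2 * sqrt (\<delta> * real n) * (ewens \<theta> n p * cycle_moment (card (orbit p 1))))"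
  proof (rule sum_mono)
    fix p assume p: "p \<in> ?B"
    let ?k = "card (orbit p 1)"
    have k: "?k \<ge> 1" using card_orbit_permutes(1)[of p n 1] p assms by simp
    have "1 \<le> (cycle_moment ?k)\<^sup>2 * (4 * real ?k - 3)" by (rule cycle_moment_lower[OF k])
    also have "\<dots> \<le> (cycle_moment ?k)\<^sup>2 * (4 * (\<delta> * real n))"
      using p by (intro mult_left_mono) auto
    also have "\<dots> = (2 * sqrt (\<delta> * real n) * cycle_moment ?k)\<^sup>2"
      using assms by (simp add: power_mult_distrib)
    finally have "1\<^sup>2 \<le> (2 * sqrt (\<delta> * real n) * cycle_moment ?k)\<^sup>2"
      by simp
    then have "1 \<le> 2 * sqrt (\<delta> * real n) * cycle_moment ?k"
      using assms cycle_moment_pos[of ?k] by (intro power2_le_imp_le[of 1]) auto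
    then show "ewens \<theta> n p \<le> 2 * sqrt (\<delta> * real n) * (ewens \<theta> n p * cycle_moment ?k)"
      using mult_left_mono[OF _ ew, of 1 "2 * sqrt (\<delta> * real n) * cycle_moment ?k" p]
      by (simp add: mult_ac)
  qed
  also have "\<dots> \<le> 2 * sqrt (\<delta> * real n) * E"
    unfolding sum_distrib_left[symmetric] E_def using assms fin ew cycle_moment_pos
    by (intro mult_left_mono sum_mono2) (auto intro!: mult_nonneg_nonneg simp: less_imp_le)
  also have "\<dots> = 2 * sqrt (\<delta> * (real n * E\<^sup>2))"
  proof -
    have "E \<ge> 0" unfolding E_def using ew cycle_moment_pos by (auto intro!: sum_nonneg simp: less_imp_le)
    then show ?thesis using assms by (simp add: real_sqrt_mult)
  qed
  also have "\<dots> \<le> 2 * sqrt (\<delta> * (1 + \<theta>))"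
  proof -
    have "real n * E\<^sup>2 \<le> E\<^sup>2 * (real n + \<theta>)" using assms by (simp add: algebra_simps)
    also have "\<dots> \<le> 1 + \<theta>" unfolding E_def by (rule ewens_cycle_moment[OF assms(1,2)])
    finally show ?thesis using assms by simp
  qed
  finally show ?thesis .
qed

subsection \<open>Eigenvalues of weighted permutation matrices\<close>

lemma weighted_perm_mat_carrier [simp]: "weighted_perm_mat n w p \<in> carrier_mat n n"
  unfolding weighted_perm_mat_def by simp

lemma perm_mat_eq_weighted: "perm_mat n p = weighted_perm_mat n (\<lambda>_. 1) p"
  unfolding perm_mat_def weighted_perm_mat_def ..

text \<open>Row \<open>p j\<close> can have a nonzero entry only in column \<open>j\<close>.
  Enumerating the rows as \<open>p j\<close> turns the eigenvector equation into a recursion along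
  the cycles, free of the inverse permutation and of the index shift.\<close>

lemma eigenvalue_weighted_perm_mat_iff:
  assumes p: "p permutes {1..n}"
  shows "eigenvalue (weighted_perm_mat n w p) c \<longleftrightarrow>
    (\<exists>u. (\<exists>j\<in>{1..n}. u j \<noteq> 0) \<and> (\<forall>j\<in>{1..n}. c * u (p j) = w (p j) * u j))"
proof -
  let ?A = "weighted_perm_mat n w p"
  have pS: "p j \<in> {1..n}" if "j \<in> {1..n}" for j using permutes_in_image[OF p] that by blast
  have mult: "(?A *\<^sub>v v) $ (p j - 1) = w (p j) * v $ (j - 1)"
    if v: "v \<in> carrier_vec n" and j: "j \<in> {1..n}" for v j
  proof -
    have l: "p j - 1 < n" "j - 1 < n" "Suc (p j - 1) = p j" "Suc (j - 1) = j"
      using pS[OF j] j by auto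
    have "(?A *\<^sub>v v) $ (p j - 1) = (\<Sum>i\<in>{0..<n}. (if p j = p (Suc i) then w (p j) else 0) * v $ i)"
      using v l(1,2) by (simp add: weighted_perm_mat_def scalar_prod_def l(3) del: One_nat_def cong: if_cong)
    also have "\<dots> = (\<Sum>i\<in>{0..<n}. if i = j - 1 then w (p j) * v $ i else 0)"
    proof (rule sum.cong[OF refl])
      fix i assume "i \<in> {0..<n}"
      have "p j = p (Suc i) \<longleftrightarrow> i = j - 1"
        using injD[OF permutes_inj[OF p], of j "Suc i"] l(4) by auto
      then show "(if p j = p (Suc i) then w (p j) else 0) * v $ i = (if i = j - 1 then w (p j) * v $ i else 0)"
        by simp
    qed
    also have "\<dots> = w (p j) * v $ (j - 1)" using l by (simp add: sum.delta)
    finally show ?thesis .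
  qed
  have eq_iff: "?A *\<^sub>v v = c \<cdot>\<^sub>v v \<longleftrightarrow> (\<forall>j\<in>{1..n}. c * v $ (p j - 1) = w (p j) * v $ (j - 1))"
    if v: "v \<in> carrier_vec n" for v
  proof
    assume "?A *\<^sub>v v = c \<cdot>\<^sub>v v"
    then show "\<forall>j\<in>{1..n}. c * v $ (p j - 1) = w (p j) * v $ (j - 1)"
      using mult[OF v] pS v by (fastforce simp: weighted_perm_mat_def)
  next
    assume R: "\<forall>j\<in>{1..n}. c * v $ (p j - 1) = w (p j) * v $ (j - 1)"
    show "?A *\<^sub>v v = c \<cdot>\<^sub>v v"
    proof (rule eq_vecI)
      show "dim_vec (?A *\<^sub>v v) = dim_vec (c \<cdot>\<^sub>v v)" using v by (simp add: weighted_perm_mat_def)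
      fix i assume "i < dim_vec (c \<cdot>\<^sub>v v)"
      then have i: "i < n" using v by simp
      then have "Suc i \<in> {1..n}" by simp
      then obtain j where j: "j \<in> {1..n}" "p j = Suc i" using permutes_image[OF p] by (metis imageE)
      show "(?A *\<^sub>v v) $ i = (c \<cdot>\<^sub>v v) $ i" using mult[OF v j(1)] bspec[OF R j(1)] j(2) v i by simp
    qed
  qed
  show ?thesis
  proof
    assume "eigenvalue ?A c"
    then obtain v where v: "v \<in> carrier_vec n" "v \<noteq> 0\<^sub>v n" "?A *\<^sub>v v = c \<cdot>\<^sub>v v"
      unfolding eigenvalue_def eigenvector_def by (auto simp: weighted_perm_mat_def)
    then obtain i where "i < n" "v $ i \<noteq> 0" by (metis eq_vecI carrier_vecD index_zero_vec)
    then show "\<exists>u. (\<exists>j\<in>{1..n}. u j \<noteq> 0) \<and> (\<forall>j\<in>{1..n}. c * u (p j) = w (p j) * u j)"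
      using eq_iff[OF v(1)] v(3) by (intro exI[of _ "\<lambda>j. v $ (j - 1)"]) (auto intro!: bexI[of _ "Suc i"])
  next
    assume "\<exists>u. (\<exists>j\<in>{1..n}. u j \<noteq> 0) \<and> (\<forall>j\<in>{1..n}. c * u (p j) = w (p j) * u j)"
    then obtain u j where u: "j \<in> {1..n}" "u j \<noteq> 0" "\<forall>j\<in>{1..n}. c * u (p j) = w (p j) * u j"
      by blast
    define v where "v = vec n (\<lambda>i. u (Suc i))"
    have vc: "v \<in> carrier_vec n" by (simp add: v_def)
    have vu: "v $ (i - 1) = u i" if "i \<in> {1..n}" for i using that by (cases i) (auto simp: v_def)
    have "v \<noteq> 0\<^sub>v n" using vu[OF u(1)] u(1,2) by auto
    moreover have "?A *\<^sub>v v = c \<cdot>\<^sub>v v"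
      unfolding eq_iff[OF vc]
    proof
      fix i assume i: "i \<in> {1..n}"
      show "c * v $ (p i - 1) = w (p i) * v $ (i - 1)"
        unfolding vu[OF i] vu[OF pS[OF i]] using u(3) i by blast
    qed
    ultimately show "eigenvalue ?A c" unfolding eigenvalue_def eigenvector_def
      using vc by (auto simp: weighted_perm_mat_def)
  qed
qed

lemma orbit_enumeration:
  assumes "permutation p"
  obtains d where "d \<ge> 1" "(p ^^ d) j = j" "bij_betw (\<lambda>m. (p ^^ m) j) {..<d} (orbit p j)"
    "card (orbit p j) = d"
proof -
  have j: "j \<in> orbit p j" using permutation_self_in_orbit[OF assms] .
  let ?d = "funpow_dist1 p j j"
  have b: "bij_betw (\<lambda>m. (p ^^ m) j) {..<?d} (orbit p j)"
    unfolding bij_betw_def using inj_on_funpow_dist1[OF j] orbit_conv_funpow_dist1[OF j]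
    by (simp add: atLeast0LessThan)
  show thesis
    using that[of ?d] funpow_dist1_prop[OF j] b bij_betw_same_card[OF b] by simp
qed

text \<open>The eigenvector recursion picks up the weight of each point on arrival, so its product
  runs from \<open>p j\<close> to \<open>(p ^^ d) j\<close>. The latter is \<open>j\<close> again,
  hence a full turn collects each weight of the cycle once.\<close>

lemma prod_orbit_shift:
  fixes w :: "'a \<Rightarrow> 'b::comm_monoid_mult"
  assumes "bij_betw (\<lambda>m. (p ^^ m) j) {..<d} (orbit p j)" "(p ^^ d) j = j"
  shows "(\<Prod>m<d. w ((p ^^ Suc m) j)) = prod w (orbit p j)"
proof (cases d)
  case 0
  then show ?thesis using assms orbit_nonempty[of p j] by (simp add: bij_betw_def)
next
  case (Suc e)
  have "(\<Prod>m<Suc e. w ((p ^^ Suc m) j)) = (\<Prod>m<Suc e. w ((p ^^ m) j))"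
    using assms(2) Suc
    unfolding prod.lessThan_Suc_shift[of "\<lambda>m. w ((p ^^ m) j)"] prod.lessThan_Suc[of "\<lambda>m. w ((p ^^ Suc m) j)"]
    by (simp add: mult.commute)
  also have "\<dots> = prod w (orbit p j)"
    using prod.reindex_bij_betw[OF assms(1), of w] Suc by simp
  finally show ?thesis using Suc by simp
qed

text \<open>Going once around a cycle on which an eigenvector does not vanish yields the equation
  for \<open>c\<close>. Conversely, this equation is the condition under which values propagated
  from \<open>j\<close> are consistent after a full turn; they are extended by 0 to the other
  cycles.\<close>

lemma eigenvalue_weighted_perm_mat:
  assumes p: "p permutes {1..n}" and c: "c \<noteq> 0"
  shows "eigenvalue (weighted_perm_mat n w p) c \<longleftrightarrow>
    (\<exists>j\<in>{1..n}. c ^ card (orbit p j) = prod w (orbit p j))"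
proof -
  have perm: "permutation p" using p by (meson finite_atLeastAtMost permutation_permutes)
  show ?thesis
  proof
    assume "eigenvalue (weighted_perm_mat n w p) c"
    then obtain u j where j: "j \<in> {1..n}" "u j \<noteq> 0"
      and u: "\<And>j. j \<in> {1..n} \<Longrightarrow> c * u (p j) = w (p j) * u j"
      unfolding eigenvalue_weighted_perm_mat_iff[OF p] by blast
    obtain d where d: "d \<ge> 1" "(p ^^ d) j = j" "bij_betw (\<lambda>m. (p ^^ m) j) {..<d} (orbit p j)"
      "card (orbit p j) = d" by (rule orbit_enumeration[OF perm])
    have S: "(p ^^ k) j \<in> {1..n}" for k
      using j(1) permutes_in_image[OF p] by (induction k) simp_all
    have "c ^ k * u ((p ^^ k) j) = (\<Prod>m<k. w ((p ^^ Suc m) j)) * u j" for k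
    proof (induction k)
      case (Suc k)
      have "c ^ Suc k * u ((p ^^ Suc k) j) = c ^ k * (c * u (p ((p ^^ k) j)))" by simp
      also have "\<dots> = w ((p ^^ Suc k) j) * (c ^ k * u ((p ^^ k) j))"
        unfolding u[OF S] by simp
      finally show ?case unfolding Suc by simp
    qed simp
    from this[of d] have "c ^ d * u j = prod w (orbit p j) * u j"
      unfolding d(2) prod_orbit_shift[OF d(3,2)] .
    then show "\<exists>j\<in>{1..n}. c ^ card (orbit p j) = prod w (orbit p j)" using j d(4) by auto
  next
    assume "\<exists>j\<in>{1..n}. c ^ card (orbit p j) = prod w (orbit p j)"
    then obtain j where j: "j \<in> {1..n}" and cj: "c ^ card (orbit p j) = prod w (orbit p j)" by blast
    obtain d where d: "d \<ge> 1" "(p ^^ d) j = j" "bij_betw (\<lambda>m. (p ^^ m) j) {..<d} (orbit p j)"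
      "card (orbit p j) = d" by (rule orbit_enumeration[OF perm])
    \<comment> \<open>The value that the recursion forces at \<open>(p ^^ k) j\<close> when it
      starts from 1 at \<open>j\<close>.\<close>
    define g where "g k = (\<Prod>m<k. w ((p ^^ Suc m) j)) / c ^ k" for k
    define u where "u x = (if x \<in> orbit p j
      then g (inv_into {..<d} (\<lambda>m. (p ^^ m) j) x) else 0)" for x
    have orb: "(p ^^ k) j \<in> orbit p j" for k
      using funpow_in_orbit permutation_self_in_orbit[OF perm] by fast
    have ug: "u ((p ^^ k) j) = g k" if "k < d" for k
      using that orb bij_betw_inv_into_left[OF d(3), of k] unfolding u_def by simp
    have gS: "c * g (Suc k) = w ((p ^^ Suc k) j) * g k" for k
      unfolding g_def using c by simp
    have gd: "g d = 1"
      unfolding g_def prod_orbit_shift[OF d(3,2)] using cj[symmetric] c d(4) by simp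
    have g0: "g 0 = 1" unfolding g_def by simp
    have "c * u (p x) = w (p x) * u x" for x
    proof (cases "x \<in> orbit p j")
      case True
      then obtain k where k: "k < d" "x = (p ^^ k) j" using d(3) unfolding bij_betw_def by blast
      have "u (p x) = g (Suc k)"
      proof (cases "Suc k < d")
        case False
        then have "Suc k = d" using k by simp
        then show ?thesis using ug[of 0] d(1,2) k(2) gd g0 by auto
      qed (use ug[of "Suc k"] k in simp)
      then show ?thesis using gS[of k] ug[OF k(1)] k(2) by simp
    next
      case False
      \<comment> \<open>Orbits also contain the preimages of their points, so a point outside the
        orbit is sent outside, where \<open>u\<close> is 0 as well.\<close>
      have "x \<in> orbit p (p x)"
        using permutation_orbit_step[OF perm, of x] permutation_self_in_orbit[OF perm, of x] by simp
      then have "p x \<notin> orbit p j" using False orbit_trans by fast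
      then show ?thesis using False by (simp add: u_def)
    qed
    moreover have "u j \<noteq> 0" using ug[of 0] d(1) g0 by simp
    ultimately show "eigenvalue (weighted_perm_mat n w p) c"
      unfolding eigenvalue_weighted_perm_mat_iff[OF p] using j by blast
  qed
qed

lemma eigenangles_weighted_perm_mat:
  assumes "p permutes {1..n}"
  shows "t \<in> eigenangles (weighted_perm_mat n w p) \<longleftrightarrow>
    (\<exists>j\<in>{1..n}. cis (real (card (orbit p j)) * t) = prod w (orbit p j))"
  unfolding eigenangles_def mem_Collect_eq
  by (subst eigenvalue_weighted_perm_mat[OF assms]) (simp_all only: Complex.DeMoivre cis_neq_zero not_False_eq_True)

subsection \<open>Spacings\<close>

lemma eigenangles_periodic:
  "t + 2 * pi * of_int k \<in> eigenangles A \<longleftrightarrow> t \<in> eigenangles A"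
  unfolding eigenangles_def by (simp add: cis_mult[symmetric] del: cis_mult)

lemma inj_on_cis_period: "inj_on cis {c<..c + 2 * pi}"
proof (rule inj_onI)
  fix x y assume xy: "x \<in> {c<..c + 2 * pi}" "y \<in> {c<..c + 2 * pi}" and "cis x = cis y"
  then have "cis (x - y) = 1" by (simp add: cis_divide[symmetric])
  then have "cos (x - y) = 1" by (metis cis.sel(1) one_complex.sel(1))
  then obtain k :: int where k: "x - y = k * 2 * pi" by (auto simp: cos_one_2pi_int)
  have "\<bar>x - y\<bar> < 1 * (2 * pi)" using xy by auto
  then have "\<bar>of_int k :: real\<bar> * (2 * pi) < 1 * (2 * pi)" unfolding k by (simp add: abs_mult)
  then have "\<bar>of_int k :: real\<bar> < 1" by (rule mult_right_less_imp_less) simp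
  then have "k = 0" by (simp flip: of_int_abs)
  then show "x = y" using k by simp
qed

text \<open>\<open>cis\<close> embeds a half-open period into the spectrum, which has at most
  \<open>n\<close> elements. The starting point \<open>c\<close> is left free for the pigeonhole
  argument in \<open>max_spacing_lower\<close>.\<close>

lemma finite_eigenangles:
  assumes "A \<in> carrier_mat n n"
  shows "finite (eigenangles A \<inter> {c<..c + 2 * pi})" "card (eigenangles A \<inter> {c<..c + 2 * pi}) \<le> n"
proof -
  let ?F = "eigenangles A \<inter> {c<..c + 2 * pi}"
  have sub: "cis ` ?F \<subseteq> spectrum A" unfolding eigenangles_def spectrum_def by auto
  have inj: "inj_on cis ?F" using inj_on_cis_period by (rule inj_on_subset) auto
  show "finite ?F"
    using finite_subset[OF sub card_finite_spectrum(1)[OF assms]] inj by (simp add: finite_image_iff)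
  show "card ?F \<le> n"
    using card_mono[OF card_finite_spectrum(1)[OF assms] sub] card_finite_spectrum(2)[OF assms]
    by (simp add: card_image[OF inj])
qed

lemma shift_into_period:
  fixes t c h :: real
  assumes "h > 0"
  obtains k :: int where "t + h * of_int k \<in> {c<..c + h}"
proof -
  define k where "k = \<lfloor>(c - t) / h\<rfloor> + 1"
  have "(c - t) / h < of_int k" "of_int k \<le> (c - t) / h + 1" unfolding k_def by linarith+
  then have "c < t + h * of_int k" "t + h * of_int k \<le> c + h"
    using assms by (auto simp: field_simps)
  then show thesis using that[of k] by simp
qed

lemma next_eigenangle:
  assumes A: "A \<in> carrier_mat n n" and ne: "eigenangles A \<noteq> {}"
  obtains b where "b \<in> eigenangles A" "a < b" "b \<le> a + 2 * pi" "{a<..<b} \<inter> eigenangles A = {}"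
proof -
  let ?F = "eigenangles A \<inter> {a<..a + 2 * pi}"
  obtain t where "t \<in> eigenangles A" using ne by blast
  moreover obtain k where "t + 2 * pi * of_int k \<in> {a<..a + 2 * pi}"
    using shift_into_period[of "2 * pi"] by (metis pi_gt_zero mult_pos_pos zero_less_numeral)
  ultimately have "?F \<noteq> {}" using eigenangles_periodic by blast
  then have "Min ?F \<in> ?F" using Min_in[OF finite_eigenangles(1)[OF A]] by blast
  have le: "\<forall>x\<in>?F. Min ?F \<le> x" using Min_le[OF finite_eigenangles(1)[OF A]] by blast
  have "{a<..<Min ?F} \<inter> eigenangles A = {}"
  proof (rule ccontr)
    assume "{a<..<Min ?F} \<inter> eigenangles A \<noteq> {}"
    then obtain x where "a < x" "x < Min ?F" "x \<in> eigenangles A" by auto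
    then show False using le \<open>Min ?F \<in> ?F\<close> by force
  qed
  then show thesis using that[of "Min ?F"] \<open>Min ?F \<in> ?F\<close> by simp
qed

text \<open>The window is closed at \<open>a\<close>, so \<open>b = a\<close> is allowed, unlike in
  \<open>next_eigenangle\<close>. The pair serves to enlarge an interval without eigenangles to a
  full gap.\<close>

lemma prev_eigenangle:
  assumes A: "A \<in> carrier_mat n n" and ne: "eigenangles A \<noteq> {}"
  obtains b where "b \<in> eigenangles A" "b \<le> a" "{b<..a} \<inter> eigenangles A = {}"
proof -
  let ?F = "eigenangles A \<inter> {a - 2 * pi<..a}"
  obtain t where "t \<in> eigenangles A" using ne by blast
  moreover obtain k where "t + 2 * pi * of_int k \<in> {a - 2 * pi<..a - 2 * pi + 2 * pi}"
    using shift_into_period[of "2 * pi"] by (metis pi_gt_zero mult_pos_pos zero_less_numeral)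
  ultimately have "t + 2 * pi * of_int k \<in> ?F" using eigenangles_periodic by auto
  then have "?F \<noteq> {}" by blast
  have "finite ?F" using finite_eigenangles(1)[OF A, of "a - 2 * pi"] by simp
  then have "Max ?F \<in> ?F" and le: "\<forall>x\<in>?F. x \<le> Max ?F"
    using Max_in[OF _ \<open>?F \<noteq> {}\<close>] Max_ge by blast+
  have "{Max ?F<..a} \<inter> eigenangles A = {}"
  proof (rule ccontr)
    assume "{Max ?F<..a} \<inter> eigenangles A \<noteq> {}"
    then obtain x where "Max ?F < x" "x \<le> a" "x \<in> eigenangles A" by auto
    then show False using le \<open>Max ?F \<in> ?F\<close> by force
  qed
  then show thesis using that[of "Max ?F"] \<open>Max ?F \<in> ?F\<close> by simp
qed

text \<open>By periodicity the left end of a gap can be moved into (0, 2 pi]. The right end is at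
  most 2 pi further, so all spacings are differences of the finitely many eigenangles in (0, 4 pi].
  This is what makes \<open>Max\<close> meaningful in \<open>max_spacing\<close>.\<close>

lemma spacings_finite_nonempty:
  assumes A: "A \<in> carrier_mat n n" and ne: "eigenangles A \<noteq> {}"
  shows "finite (spacings A)" "spacings A \<noteq> {}"
proof -
  let ?E = "eigenangles A"
  have fin: "finite (?E \<inter> {0<..4 * pi})"
  proof (rule finite_subset)
    show "?E \<inter> {0<..4 * pi} \<subseteq> (?E \<inter> {0<..0 + 2 * pi}) \<union> (?E \<inter> {2 * pi<..2 * pi + 2 * pi})"
      by auto
  qed (use finite_eigenangles(1)[OF A] in blast)
  have "spacings A \<subseteq> (\<lambda>(a, b). b - a) ` ((?E \<inter> {0<..4 * pi}) \<times> (?E \<inter> {0<..4 * pi}))"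
  proof
    fix s assume "s \<in> spacings A"
    then obtain a b where ab: "s = b - a" "a \<in> ?E" "b \<in> ?E" "a < b" "{a<..<b} \<inter> ?E = {}"
      unfolding spacings_def by blast
    obtain k where k: "a + 2 * pi * of_int k \<in> {0<..0 + 2 * pi}"
      using shift_into_period[of "2 * pi"] by (metis pi_gt_zero mult_pos_pos zero_less_numeral)
    obtain b' where b': "b' \<in> ?E" "a < b'" "b' \<le> a + 2 * pi"
      using next_eigenangle[OF A ne] by metis
    have "b \<le> b'"
    proof (rule ccontr)
      assume "\<not> b \<le> b'"
      then have "b' \<in> {a<..<b} \<inter> ?E" using b' by simp
      then show False using ab(5) by blast
    qed
    then have "b \<le> a + 2 * pi" using b'(3) by simp
    then have "(a + 2 * pi * of_int k, b + 2 * pi * of_int k) \<in> (?E \<inter> {0<..4 * pi}) \<times> (?E \<inter> {0<..4 * pi})"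
      using k ab by (auto simp: eigenangles_periodic)
    then show "s \<in> (\<lambda>(a, b). b - a) ` ((?E \<inter> {0<..4 * pi}) \<times> (?E \<inter> {0<..4 * pi}))"
      by (rule rev_image_eqI) (simp add: ab)
  qed
  then show "finite (spacings A)" using fin by (meson finite_SigmaI finite_imageI finite_subset)
  obtain a where a: "a \<in> ?E" using ne by blast
  obtain b where "b \<in> ?E" "a < b" "{a<..<b} \<inter> ?E = {}" using next_eigenangle[OF A ne] by metis
  then show "spacings A \<noteq> {}" unfolding spacings_def using a by blast
qed

text \<open>Prepares measurability: the event becomes a countable union over rational intervals, and
  the intervals are closed so that their images on the circle are compact.\<close>

lemma less_max_spacing_iff:
  assumes A: "A \<in> carrier_mat n n" and ne: "eigenangles A \<noteq> {}"
  shows "c < max_spacing A \<longleftrightarrow>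
    (\<exists>q r :: rat. q < r \<and> c < of_rat r - of_rat q \<and> {of_rat q..of_rat r} \<inter> eigenangles A = {})"
proof -
  let ?E = "eigenangles A"
  have "c < max_spacing A \<longleftrightarrow> (\<exists>s\<in>spacings A. c < s)"
    unfolding max_spacing_def using spacings_finite_nonempty[OF A ne] by (rule Max_gr_iff)
  also have "\<dots> \<longleftrightarrow> (\<exists>q r :: rat. q < r \<and> c < of_rat r - of_rat q \<and> {of_rat q..of_rat r} \<inter> ?E = {})"
  proof
    assume "\<exists>s\<in>spacings A. c < s"
    then obtain a b where ab: "c < b - a" "a < b" "{a<..<b} \<inter> ?E = {}"
      unfolding spacings_def by blast
    \<comment> \<open>Moving both ends of the gap inwards by less than \<open>e\<close> keeps
      \<open>q < r\<close> (first term) and a length above \<open>c\<close> (second term);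
      \<open>c\<close> may be negative, so both are required.\<close>
    define e where "e = min ((b - a) / 2) ((b - a - c) / 2)"
    have e: "e > 0" using ab by (simp add: e_def)
    obtain q r where q: "a < of_rat q" "of_rat q < a + e" and r: "b - e < of_rat r" "of_rat r < b"
      using of_rat_dense[of a "a + e"] of_rat_dense[of "b - e" b] e by auto
    have "2 * e \<le> b - a" "2 * e \<le> b - a - c" unfolding e_def by (auto simp: min_def)
    then have "(of_rat q :: real) < of_rat r" "c < of_rat r - of_rat q" using q r by linarith+
    moreover have "{of_rat q..of_rat r} \<subseteq> {a<..<b}" using q r by auto
    ultimately show "\<exists>q r :: rat. q < r \<and> c < of_rat r - of_rat q \<and> {of_rat q..of_rat r} \<inter> ?E = {}"
      using ab(3) by (intro exI[of _ q] exI[of _ r]) (auto simp: of_rat_less)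
  next
    assume "\<exists>q r :: rat. q < r \<and> c < of_rat r - of_rat q \<and> {of_rat q..of_rat r} \<inter> ?E = {}"
    then obtain q r :: real where qr: "q < r" "c < r - q" "{q..r} \<inter> ?E = {}"
      by (metis of_rat_less)
    obtain a where a: "a \<in> ?E" "a \<le> q" "{a<..q} \<inter> ?E = {}"
      using prev_eigenangle[OF A ne] by metis
    obtain b where b: "b \<in> ?E" "r < b" "{r<..<b} \<inter> ?E = {}"
      using next_eigenangle[OF A ne] by metis
    have "{a<..<b} \<subseteq> {a<..q} \<union> {q..r} \<union> {r<..<b}" by auto
    then have "{a<..<b} \<inter> ?E = {}" using a(3) b(3) qr(3) by blast
    then have "b - a \<in> spacings A" unfolding spacings_def using a b qr by force
    then show "\<exists>s\<in>spacings A. c < s" using a b qr by force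
  qed
  finally show ?thesis .
qed

text \<open>Pigeonhole: if \<open>n D < 2 pi\<close>, then \<open>n + 1\<close> successive
  eigenangles fit into one half-open period, which holds at most \<open>n\<close>. This avoids
  summing the spacings over a period.\<close>

lemma max_spacing_lower:
  assumes A: "A \<in> carrier_mat n n" and ne: "eigenangles A \<noteq> {}"
  shows "2 * pi \<le> real n * max_spacing A"
proof (rule ccontr)
  let ?E = "eigenangles A"
  define D where "D = max_spacing A"
  assume "\<not> 2 * pi \<le> real n * max_spacing A"
  then have nD: "real n * D < 2 * pi" by (simp add: D_def)
  obtain a where a: "a \<in> ?E" using ne by blast
  have "\<forall>x. \<exists>y. y \<in> ?E \<and> x < y \<and> {x<..<y} \<inter> ?E = {}" using next_eigenangle[OF A ne] by metis
  then obtain f where f: "\<And>x. f x \<in> ?E" "\<And>x. x < f x" "\<And>x. {x<..<f x} \<inter> ?E = {}" by metis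
  have gap: "f x - x \<le> D" if "x \<in> ?E" for x
  proof -
    have "f x - x \<in> spacings A" unfolding spacings_def using f[of x] that by blast
    then show ?thesis unfolding D_def max_spacing_def
      using spacings_finite_nonempty(1)[OF A ne] by (rule Max_ge[rotated])
  qed
  have D: "D \<ge> 0" using gap[OF a] f(2)[of a] by linarith
  define x where "x k = (f ^^ k) a" for k
  have xE: "x k \<in> ?E" for k unfolding x_def by (cases k) (simp_all add: a f)
  have "strict_mono x" by (rule strict_mono_Suc_iff[THEN iffD2]) (simp add: x_def f)
  then have inj: "inj_on x {..n}" by (meson inj_on_subset strict_mono_imp_inj_on subset_UNIV)
  have x_le: "x k \<le> a + real k * D" for k
  proof (induction k)
    case (Suc k)
    then show ?case using gap[OF xE, of k] by (simp add: x_def algebra_simps)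
  qed (simp add: x_def)
  have a_le: "a \<le> x k" for k using strict_mono_less_eq[OF \<open>strict_mono x\<close>, of 0 k] by (simp add: x_def)
  \<comment> \<open>The period ends at the farthest position that the last of the
    \<open>n + 1\<close> eigenangles can reach; it contains \<open>a\<close> because
    \<open>n D < 2 pi\<close>.\<close>
  define c where "c = a + real n * D - 2 * pi"
  have "x ` {..n} \<subseteq> ?E \<inter> {c<..c + 2 * pi}"
  proof (rule image_subsetI)
    fix k assume "k \<in> {..n}"
    then have "real k * D \<le> real n * D" using D by (simp add: mult_right_mono)
    then show "x k \<in> ?E \<inter> {c<..c + 2 * pi}"
      using x_le[of k] a_le[of k] nD xE[of k] unfolding c_def by simp
  qed
  then have "card {..n} \<le> card (?E \<inter> {c<..c + 2 * pi})"
    by (rule card_inj_on_le[OF inj _ finite_eigenangles(1)[OF A]])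
  also have "\<dots> \<le> n" by (rule finite_eigenangles(2)[OF A])
  finally show False by simp
qed

text \<open>The eigenangle provided within distance \<open>h\<close> of the left end of a gap cannot
  lie inside the gap, so the gap ends no later.\<close>

lemma max_spacing_upper:
  assumes A: "A \<in> carrier_mat n n" and ne: "eigenangles A \<noteq> {}"
    and h: "\<And>a. \<exists>b\<in>eigenangles A. a < b \<and> b \<le> a + h"
  shows "max_spacing A \<le> h"
proof -
  have "s \<le> h" if "s \<in> spacings A" for s
  proof -
    obtain a b where ab: "s = b - a" "{a<..<b} \<inter> eigenangles A = {}"
      using \<open>s \<in> spacings A\<close> unfolding spacings_def by blast
    obtain b' where b': "b' \<in> eigenangles A" "a < b'" "b' \<le> a + h" using h by blast
    have "\<not> b' < b" using ab(2) b' by auto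
    then show ?thesis using ab(1) b'(3) by simp
  qed
  then show ?thesis unfolding max_spacing_def
    using spacings_finite_nonempty[OF A ne] by simp
qed

subsection \<open>Tightness\<close>

text \<open>If the product of the weights over the cycle of 1 is \<open>cis s\<close>, the angles
  \<open>t\<close> with \<open>l t = s\<close> modulo 2 pi form a progression of step 2 pi / l,
  which meets every half-open interval of that length.\<close>

lemma max_spacing_weighted_perm_mat_bounds:
  assumes n: "n \<ge> 1" and p: "p permutes {1..n}" and w: "\<And>i. i \<in> {1..n} \<Longrightarrow> norm (w i) = 1"
  shows "2 * pi \<le> real n * max_spacing (weighted_perm_mat n w p)"
    and "max_spacing (weighted_perm_mat n w p) \<le> 2 * pi / real (card (orbit p 1))"
proof -
  let ?E = "eigenangles (weighted_perm_mat n w p)" and ?l = "real (card (orbit p 1))"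
  have 1: "(1::nat) \<in> {1..n}" using n by simp
  have l: "?l > 0" using card_orbit_permutes(1)[OF p 1] by simp
  have "norm (prod w (orbit p 1)) = 1"
    unfolding prod_norm[symmetric] using permutes_orbit_subset[OF p 1] w by (intro prod.neutral) blast
  then obtain s where s: "prod w (orbit p 1) = cis s"
    by (metis complex_unimodular_polar cis.code)
  have h: "\<exists>b\<in>?E. a < b \<and> b \<le> a + 2 * pi / ?l" for a
  proof -
    obtain k :: int where k: "s / ?l + 2 * pi / ?l * of_int k \<in> {a<..a + 2 * pi / ?l}"
      using shift_into_period[of "2 * pi / ?l" "s / ?l" a] l by auto
    have "?l * (s / ?l + 2 * pi / ?l * of_int k) = s + 2 * pi * of_int k"
      using l by (simp add: field_simps)
    then have "cis (?l * (s / ?l + 2 * pi / ?l * of_int k)) = prod w (orbit p 1)"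
      unfolding s by (simp add: cis_mult[symmetric] del: cis_mult)
    then have "s / ?l + 2 * pi / ?l * of_int k \<in> ?E"
      unfolding eigenangles_weighted_perm_mat[OF p] using 1 by blast
    then show ?thesis using k by auto
  qed
  then have ne: "?E \<noteq> {}" by blast
  show "2 * pi \<le> real n * max_spacing (weighted_perm_mat n w p)"
    by (rule max_spacing_lower[OF weighted_perm_mat_carrier ne])
  show "max_spacing (weighted_perm_mat n w p) \<le> 2 * pi / ?l"
    by (rule max_spacing_upper[OF weighted_perm_mat_carrier ne h])
qed

text \<open>No condition is put on the moduli of the weights, so eigenangles may be absent. On that
  event \<open>max_spacing\<close> is the constant \<open>Max {}\<close>, whatever its value;
  elsewhere \<open>less_max_spacing_iff\<close> applies.\<close>

lemma max_spacing_weighted_perm_mat_measurable: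
  assumes p: "p permutes {1..n}" and w: "\<And>i. i \<in> {1..n} \<Longrightarrow> w i \<in> borel_measurable M"
  shows "(\<lambda>\<omega>. max_spacing (weighted_perm_mat n (\<lambda>i. w i \<omega>) p)) \<in> borel_measurable M"
proof -
  let ?A = "\<lambda>\<omega>. weighted_perm_mat n (\<lambda>i. w i \<omega>) p"
  let ?E = "\<lambda>\<omega>. eigenangles (?A \<omega>)"
  \<comment> \<open>An interval is free of eigenangles iff each cycle product avoids the compact
    image of the interval under \<open>cis (l t)\<close>, \<open>l\<close> being the cycle length;
    this is an open condition on finitely many measurable products.\<close>
  have free: "{\<omega> \<in> space M. {q..r} \<inter> ?E \<omega> = {}} \<in> sets M" for q r
  proof -
    have "{\<omega> \<in> space M. {q..r} \<inter> ?E \<omega> = {}} = {\<omega> \<in> space M. \<forall>j\<in>{1..n}.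
        (\<Prod>i\<in>orbit p j. w i \<omega>) \<notin> (\<lambda>t. cis (real (card (orbit p j)) * t)) ` {q..r}}"
    proof (intro Collect_cong conj_cong refl)
      fix \<omega>
      show "{q..r} \<inter> ?E \<omega> = {} \<longleftrightarrow> (\<forall>j\<in>{1..n}.
        (\<Prod>i\<in>orbit p j. w i \<omega>) \<notin> (\<lambda>t. cis (real (card (orbit p j)) * t)) ` {q..r})"
        unfolding disjoint_iff eigenangles_weighted_perm_mat[OF p] image_iff by metis
    qed
    also have "\<dots> \<in> sets M"
    proof (rule sets.sets_Collect_finite_All)
      fix j assume "j \<in> {1..n}"
      then have orb: "orbit p j \<subseteq> {1..n}" by (rule permutes_orbit_subset[OF p])
      let ?C = "(\<lambda>t. cis (real (card (orbit p j)) * t)) ` {q..r}"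
      have "compact ?C" by (intro compact_continuous_image continuous_intros) auto
      then have "- ?C \<in> sets borel" by (intro borel_open) (auto intro: compact_imp_closed)
      moreover have "(\<lambda>\<omega>. \<Prod>i\<in>orbit p j. w i \<omega>) \<in> borel_measurable M"
        using orb w by (intro borel_measurable_prod) auto
      ultimately have "(\<lambda>\<omega>. \<Prod>i\<in>orbit p j. w i \<omega>) -` (- ?C) \<inter> space M \<in> sets M"
        by (rule measurable_sets[rotated])
      also have "(\<lambda>\<omega>. \<Prod>i\<in>orbit p j. w i \<omega>) -` (- ?C) \<inter> space M =
          {\<omega> \<in> space M. (\<Prod>i\<in>orbit p j. w i \<omega>) \<notin> ?C}" by auto
      finally show "{\<omega> \<in> space M. (\<Prod>i\<in>orbit p j. w i \<omega>) \<notin> ?C} \<in> sets M" .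
    qed simp
    finally show ?thesis .
  qed
  \<comment> \<open>Testing a single compact period makes the absence of eigenangles one of the
    events covered by \<open>free\<close>.\<close>
  have empty_iff: "?E \<omega> = {} \<longleftrightarrow> {0..2 * pi} \<inter> ?E \<omega> = {}" for \<omega>
  proof
    assume L: "{0..2 * pi} \<inter> ?E \<omega> = {}"
    show "?E \<omega> = {}"
    proof (rule ccontr)
      assume "?E \<omega> \<noteq> {}"
      then obtain t where t: "t \<in> ?E \<omega>" by blast
      obtain k where k: "t + 2 * pi * of_int k \<in> {0<..0 + 2 * pi}"
        using shift_into_period[of "2 * pi"] by (metis pi_gt_zero mult_pos_pos zero_less_numeral)
      then have "t + 2 * pi * of_int k \<in> {0..2 * pi} \<inter> ?E \<omega>"
        using t by (simp add: eigenangles_periodic)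
      then show False using L by blast
    qed
  qed auto
  have "{\<omega> \<in> space M. c < max_spacing (?A \<omega>)} \<in> sets M" for c
  proof -
    have *: "c < max_spacing (?A \<omega>) \<longleftrightarrow>
       (({0..2 * pi} \<inter> ?E \<omega> = {} \<and> c < Max {}) \<or>
        (\<not> ({0..2 * pi} \<inter> ?E \<omega> = {}) \<and>
          (\<exists>q r :: rat. q < r \<and> c < of_rat r - of_rat q \<and> {of_rat q..of_rat r} \<inter> ?E \<omega> = {})))" for \<omega>
    proof (cases "?E \<omega> = {}")
      case True
      then have "max_spacing (?A \<omega>) = Max {}" by (simp add: max_spacing_def spacings_def)
      then show ?thesis using True by simp
    next
      case False
      then show ?thesis
        unfolding less_max_spacing_iff[OF weighted_perm_mat_carrier False] using empty_iff[of \<omega>] by blast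
    qed
    show ?thesis unfolding *
      by (intro sets.sets_Collect_disj sets.sets_Collect_conj sets.sets_Collect_neg
          sets.sets_Collect_countable_Ex sets.sets_Collect_const free)
  qed
  then show ?thesis unfolding borel_measurable_iff_greater by blast
qed

text \<open>General weights of modulus 1 almost surely cover both matrix models at once.\<close>

lemma tight_max_spacing:
  fixes M :: "'a measure" and \<theta> :: real
    and \<sigma> :: "nat \<Rightarrow> 'a \<Rightarrow> nat \<Rightarrow> nat" and w :: "nat \<Rightarrow> 'a \<Rightarrow> complex"
  assumes M: "prob_space M" and \<theta>: "\<theta> > 0"
    and \<sigma>: "\<And>n. n \<ge> 1 \<Longrightarrow> \<sigma> n \<in> measurable M (count_space {p. p permutes {1..n}})"
    and ewens: "\<And>n p. n \<ge> 1 \<Longrightarrow> p permutes {1..n} \<Longrightarrow>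
           measure M {\<omega> \<in> space M. \<sigma> n \<omega> = p} = ewens \<theta> n p"
    and w: "\<And>i. i \<ge> 1 \<Longrightarrow> w i \<in> borel_measurable M"
    and w_norm: "\<And>i. i \<ge> 1 \<Longrightarrow> AE \<omega> in M. norm (w i \<omega>) = 1"
  defines "D \<equiv> (\<lambda>n \<omega>. max_spacing (weighted_perm_mat n (\<lambda>i. w i \<omega>) (\<sigma> n \<omega>)))"
  shows "tight_seq M (\<lambda>n \<omega>. real n * D n \<omega>) \<and> tight_seq M (\<lambda>n \<omega>. 1 / (real n * D n \<omega>))"
proof -
  interpret prob_space M by fact
  have D: "D n \<in> borel_measurable M" if "n \<ge> 1" for n
    unfolding D_def
  proof (rule measurable_compose_countable'[OF _ \<sigma>[OF that]])
    show "countable {p. p permutes {1..n}}"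
      by (intro countable_finite finite_permutations) simp
  qed (use w in \<open>auto intro!: max_spacing_weighted_perm_mat_measurable\<close>)
  have perm: "\<sigma> n \<omega> permutes {1..n}" if "n \<ge> 1" "\<omega> \<in> space M" for n \<omega>
    using measurable_space[OF \<sigma>[OF that(1)] that(2)] by simp
  have bounds: "AE \<omega> in M. 2 * pi \<le> real n * D n \<omega> \<and> D n \<omega> \<le> 2 * pi / real (card (orbit (\<sigma> n \<omega>) 1))"
    if n: "n \<ge> 1" for n
  proof -
    have "AE \<omega> in M. \<forall>i\<in>{1..n}. norm (w i \<omega>) = 1"
      using w_norm by (intro AE_finite_allI) auto
    then show ?thesis
    proof (rule AE_mp, intro AE_I2 impI)
      fix \<omega> assume "\<omega> \<in> space M" "\<forall>i\<in>{1..n}. norm (w i \<omega>) = 1"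
      then show "2 * pi \<le> real n * D n \<omega> \<and> D n \<omega> \<le> 2 * pi / real (card (orbit (\<sigma> n \<omega>) 1))"
        unfolding D_def
        using max_spacing_weighted_perm_mat_bounds[OF n perm[OF n], of \<omega> "\<lambda>i. w i \<omega>"] by simp
    qed
  qed
  \<comment> \<open>This \<open>\<delta>\<close> solves 2 sqrt (\<delta> (1 + \<theta>)) =
    \<epsilon>, the left side being the bound on the probability that the cycle of 1 is shorter than
    \<open>\<delta> n\<close>. On the complement, \<open>D \<le> 2 pi / l\<close> gives
    \<open>n D \<le> 2 pi / \<delta>\<close>.\<close>
  have *: "prob {\<omega> \<in> space M. \<bar>real n * D n \<omega>\<bar> \<le> 2 * pi / \<delta>} \<ge> 1 - \<epsilon>"
    if n: "n \<ge> 1" and \<epsilon>: "\<epsilon> > 0" and \<delta>: "\<delta> = \<epsilon>\<^sup>2 / (4 * (1 + \<theta>))" for n and \<epsilon> \<delta> :: real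
  proof -
    note [measurable] = D[OF n]
    have \<delta>0: "\<delta> > 0" unfolding \<delta> using \<epsilon> \<theta> by simp
    then have \<delta>n: "\<delta> * real n > 0" using n by simp
    let ?B = "{p. p permutes {1..n} \<and> real (card (orbit p 1)) < \<delta> * real n}"
    let ?S = "{\<omega> \<in> space M. \<sigma> n \<omega> \<in> ?B}"
    have fin: "finite ?B" by (rule finite_subset[OF _ finite_permutations[of "{1..n}"]]) auto
    have ev: "{\<omega> \<in> space M. \<sigma> n \<omega> = p} \<in> events" if "p \<in> ?B" for p
    proof -
      have "\<sigma> n -` {p} \<inter> space M \<in> events"
        using that by (intro measurable_sets[OF \<sigma>[OF n]]) auto
      also have "\<sigma> n -` {p} \<inter> space M = {\<omega> \<in> space M. \<sigma> n \<omega> = p}" by auto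
      finally show ?thesis .
    qed
    have S_eq: "?S = (\<Union>p\<in>?B. {\<omega> \<in> space M. \<sigma> n \<omega> = p})" by auto
    have S: "?S \<in> events" unfolding S_eq using fin ev by (intro sets.finite_UN) auto
    have "prob ?S = (\<Sum>p\<in>?B. prob {\<omega> \<in> space M. \<sigma> n \<omega> = p})"
      unfolding S_eq using fin ev by (intro finite_measure_finite_Union) (auto simp: disjoint_family_on_def)
    also have "\<dots> = sum (ewens \<theta> n) ?B" using ewens[OF n] by (intro sum.cong) auto
    also have "\<dots> \<le> 2 * sqrt (\<delta> * (1 + \<theta>))" by (rule ewens_small_cycle[OF \<theta> n \<delta>0])
    also have "\<delta> * (1 + \<theta>) = (\<epsilon> / 2)\<^sup>2"
      unfolding \<delta> using \<theta> by (simp add: field_simps power2_eq_square)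
    also have "2 * sqrt ((\<epsilon> / 2)\<^sup>2) = \<epsilon>" using \<epsilon> by simp
    finally have "1 - \<epsilon> \<le> prob (space M - ?S)" using prob_compl[OF S] by simp
    also have "\<dots> \<le> prob {\<omega> \<in> space M. \<bar>real n * D n \<omega>\<bar> \<le> 2 * pi / \<delta>}"
    proof (rule finite_measure_mono_AE)
      show "AE \<omega> in M. \<omega> \<in> space M - ?S \<longrightarrow> \<omega> \<in> {\<omega> \<in> space M. \<bar>real n * D n \<omega>\<bar> \<le> 2 * pi / \<delta>}"
        using bounds[OF n]
      proof (rule AE_mp, intro AE_I2 impI)
        fix \<omega> assume \<omega>: "\<omega> \<in> space M" "\<omega> \<in> space M - ?S"
          and b: "2 * pi \<le> real n * D n \<omega> \<and> D n \<omega> \<le> 2 * pi / real (card (orbit (\<sigma> n \<omega>) 1))"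
        have c: "\<delta> * real n \<le> real (card (orbit (\<sigma> n \<omega>) 1))" using \<omega> perm[OF n] by auto
        have "2 * pi / real (card (orbit (\<sigma> n \<omega>) 1)) \<le> 2 * pi / (\<delta> * real n)"
          by (rule divide_left_mono[OF c _ mult_pos_pos[OF less_le_trans[OF \<delta>n c] \<delta>n]]) simp
        then have "real n * D n \<omega> \<le> real n * (2 * pi / (\<delta> * real n))"
          using b by (intro mult_left_mono) auto
        also have "\<dots> = 2 * pi / \<delta>" using n by simp
        finally have "real n * D n \<omega> \<le> 2 * pi / \<delta>" .
        moreover have "0 \<le> real n * D n \<omega>" using b pi_gt_zero by linarith
        ultimately show "\<omega> \<in> {\<omega> \<in> space M. \<bar>real n * D n \<omega>\<bar> \<le> 2 * pi / \<delta>}" using \<omega> by simp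
      qed
    qed measurable
    finally show ?thesis .
  qed
  have upper: "\<exists>\<eta>>0. \<forall>n\<ge>1. prob {\<omega> \<in> space M. \<bar>real n * D n \<omega>\<bar> \<le> \<eta>} \<ge> 1 - \<epsilon>" if "\<epsilon> > 0" for \<epsilon>
  proof (intro exI conjI allI impI)
    show "2 * pi / (\<epsilon>\<^sup>2 / (4 * (1 + \<theta>))) > 0" using that \<theta> by simp
    show "prob {\<omega> \<in> space M. \<bar>real n * D n \<omega>\<bar> \<le> 2 * pi / (\<epsilon>\<^sup>2 / (4 * (1 + \<theta>)))} \<ge> 1 - \<epsilon>"
      if "n \<ge> 1" for n by (rule *[OF that \<open>\<epsilon> > 0\<close> refl])
  qed
  \<comment> \<open>Almost surely \<open>n D\<close> is at least 2 pi and so exceeds 1; thus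
    \<open>\<eta> = 1\<close> serves every \<open>\<epsilon>\<close>.\<close>
  have "prob {\<omega> \<in> space M. \<bar>1 / (real n * D n \<omega>)\<bar> \<le> 1} = 1" if n: "n \<ge> 1" for n
  proof -
    note [measurable] = D[OF n]
    have "AE \<omega> in M. \<bar>1 / (real n * D n \<omega>)\<bar> \<le> 1"
      using bounds[OF n]
    proof (rule AE_mp, intro AE_I2 impI)
      fix \<omega> assume "2 * pi \<le> real n * D n \<omega> \<and> D n \<omega> \<le> 2 * pi / real (card (orbit (\<sigma> n \<omega>) 1))"
      then have "1 \<le> real n * D n \<omega>" using pi_gt3 by linarith
      then show "\<bar>1 / (real n * D n \<omega>)\<bar> \<le> 1" by simp
    qed
    then show ?thesis by (subst prob_Collect_eq_1) measurable
  qed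
  then have lower: "\<exists>\<eta>>0. \<forall>n\<ge>1. prob {\<omega> \<in> space M. \<bar>1 / (real n * D n \<omega>)\<bar> \<le> \<eta>} \<ge> 1 - \<epsilon>" if "\<epsilon> > 0" for \<epsilon>
    using that by (intro exI[of _ 1]) auto
  show ?thesis
    unfolding tight_seq_iff[OF M] using upper lower
    by (intro conjI allI impI borel_measurable_times borel_measurable_divide borel_measurable_const D) blast+
qed

lemma AE_circle_uniform:
  assumes z: "z \<in> borel_measurable M" and "distr M borel z = circle_uniform"
  shows "AE \<omega> in M. norm (z \<omega>) = 1"
proof -
  have cis: "cis \<in> uniform_measure lborel {0..<2 * pi} \<rightarrow>\<^sub>M borel"
    using borel_measurable_continuous_onI[of cis] by (simp add: continuous_on_cis continuous_on_id)
  have "AE x in distr M borel z. norm x = 1"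
    unfolding assms(2) circle_uniform_def by (subst AE_distr_iff[OF cis]) auto
  then show ?thesis by (rule AE_distrD[OF z])
qed

theorem proposition27:
  fixes M :: "'a measure" and \<theta> :: real
    and \<sigma> :: "nat \<Rightarrow> 'a \<Rightarrow> nat \<Rightarrow> nat" and z :: "nat \<Rightarrow> 'a \<Rightarrow> complex"
  assumes "prob_space M" and "\<theta> > 0"
    and "\<And>n. n \<ge> 1 \<Longrightarrow> \<sigma> n \<in> measurable M (count_space {p. p permutes {1..n}})"
    and "\<And>n p. n \<ge> 1 \<Longrightarrow> p permutes {1..n} \<Longrightarrow>
           measure M {\<omega> \<in> space M. \<sigma> n \<omega> = p} = ewens \<theta> n p"
    and "prob_space.indep_vars M (\<lambda>_. borel) z {1..}"
    and "\<And>j. j \<ge> 1 \<Longrightarrow> distr M borel (z j) = circle_uniform"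
    and "indep_rv M
           (Pi\<^sub>M {1..} (\<lambda>_. borel)) (\<lambda>\<omega>. \<lambda>j\<in>{1..}. z j \<omega>)
           (Pi\<^sub>M {1..} (\<lambda>n. count_space {p. p permutes {1..n}})) (\<lambda>\<omega>. \<lambda>n\<in>{1..}. \<sigma> n \<omega>)"
  shows "tight_seq M (\<lambda>n \<omega>. real n * max_spacing (perm_mat n (\<sigma> n \<omega>))) \<and>
         tight_seq M (\<lambda>n \<omega>. real n * max_spacing (weighted_perm_mat n (\<lambda>i. z i \<omega>) (\<sigma> n \<omega>))) \<and>
         tight_seq M (\<lambda>n \<omega>. 1 / (real n * max_spacing (perm_mat n (\<sigma> n \<omega>)))) \<and>
         tight_seq M (\<lambda>n \<omega>. 1 / (real n * max_spacing (weighted_perm_mat n (\<lambda>i. z i \<omega>) (\<sigma> n \<omega>))))"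
proof -
  have z: "z j \<in> borel_measurable M" if "j \<ge> 1" for j
    using assms(5) that unfolding prob_space.indep_vars_def[OF assms(1)] by simp
  have "AE \<omega> in M. norm (z j \<omega>) = 1" if "j \<ge> 1" for j
    by (rule AE_circle_uniform[OF z[OF that] assms(6)[OF that]])
  note weighted = tight_max_spacing[OF assms(1-4) z this]
  have unweighted: "tight_seq M (\<lambda>n \<omega>. real n * max_spacing (perm_mat n (\<sigma> n \<omega>))) \<and>
      tight_seq M (\<lambda>n \<omega>. 1 / (real n * max_spacing (perm_mat n (\<sigma> n \<omega>))))"
    unfolding perm_mat_eq_weighted
    by (rule tight_max_spacing[OF assms(1-4), where w = "\<lambda>_ _. 1"]) auto
  from weighted unweighted show ?thesis by simp
qed

end
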